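(* Let $(\mathcal S,\mathcal A)$ be a measurable space, $\pi$ a probability measure on it, and $X$ a random variable with $X\sim\pi$. Let $\mathcal M$ be a countable set and, for each $\ell\in\mathcal M$, let $g_\ell:(\mathcal S,\mathcal A)\to(\mathcal G_\ell,\mathcal B_\ell)$ be a measurable function into a measurable space with $\{g\}\in\mathcal B_\ell$ for all $g\in\mathcal G_\ell$. For $s'\in\mathcal S$ put $\mathfrak R_\ell(s')=\{s\in\mathcal S\mid g_\ell(s)=g_\ell(s')\}$. Suppose that for each $\ell\in\mathcal M$: - there are a measure $\lambda_\ell$ on $\mathcal A$ and a kernel density $p_\ell$ from $(\mathcal G_\ell,\mathcal B_\ell)$ to $(\mathcal S,\mathcal A,\lambda_\ell)$ with $\mathbb P(X\in ds\mid g_\ell(X)=g)=p_\ell(g,s)\,\lambda_\ell(ds)$, and for all $s'\in\mathcal S$ the restriction of $\lambda_\ell$ to $\mathfrak R_\ell(s')$ is $\sigma$-finite; - $k_\ell$ is a kernel density from $(\mathcal S,\mathcal A)$ to $(\mathcal S,\mathcal A,\lambda_\ell)$ such that $K_\ell(s',ds)=k_\ell(s',s)\lambda_\ell(ds)$ satisfies $K_\ell(s',\mathfrak R_\ell(s'))=1$ for all $s'\in\mathcal S$; - $q_\ell:\mathcal S\to[0,1]$ is measurable, with $\sum_{\ell\in\mathcal M}q_\ell(s')=1$ for all $s'\in\mathcal S$. Then the transition kernel $$\mu(s',\cdot)=\sum_{\ell\in\mathcal M}q_\ell(s')\int \Big( a^\ell_{s's}\,\delta_s(\cdot)+\big(1-a^\ell_{s's}\big)\delta_{s'}(\cdot)\Big)K_\ell(s',ds)$$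 with acceptance probability $$a^\ell_{s's}=\min\left\{1,\ \frac{p_\ell(g,s)\,k_\ell(s,s')}{p_\ell(g,s')\,k_\ell(s',s)}\cdot\frac{q_\ell(s)}{q_\ell(s')}\right\},\qquad g=g_\ell(s')=g_\ell(s),$$ preserves the detailed balance condition w.r.t. $\pi$.
   Context: A kernel density from a measurable space $(E,\mathcal E)$ to a measure space $(F,\mathcal F,\rho)$ is a jointly measurable function $k:E\times F\to[0,\infty)$ with $\int k(x,y)\rho(dy)=1$ for all $x\in E$. Given the current state $s'$, only states $s\in\mathfrak R_\ell(s')$ are proposed in move $\ell$ (up to $K_\ell(s',\cdot)$-null sets), so $a^\ell_{s's}$ need only be specified for $g_\ell(s)=g_\ell(s')$. Convention: an acceptance probability is set to $0$ wherever its defining expression is not defined (zero denominator). Detailed balance: a Markov kernel $\mu$ on $(\mathcal S,\mathcal A)$ preserves the detailed balance condition w.r.t. $\pi$ if $\pi\otimes\mu(A\times B)=\pi\otimes\mu(B\times A)$ for all $A,B\in\mathcal A$, where $\pi\otimes\mu(A\times B)=\int_A\mu(s',B)\,\pi(ds')$. *)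

theory Defs
  imports "HOL-Probability.Probability"
begin

definition kernel_density ::
  "'a measure \<Rightarrow> 'b measure \<Rightarrow> ('a \<Rightarrow> 'b \<Rightarrow> real) \<Rightarrow> bool" where
  "kernel_density E \<rho> k \<longleftrightarrow>
     (\<lambda>(x, y). k x y) \<in> borel_measurable (E \<Otimes>\<^sub>M \<rho>) \<and>
     (\<forall>x\<in>space E. \<forall>y\<in>space \<rho>. 0 \<le> k x y) \<and>
     (\<forall>x\<in>space E. (\<integral>\<^sup>+ y. ennreal (k x y) \<partial>\<rho>) = 1)"

definition density_kernel :: "'b measure \<Rightarrow> ('a \<Rightarrow> 'b \<Rightarrow> real) \<Rightarrow> 'a \<Rightarrow> 'b measure" where
  "density_kernel \<rho> k x = density \<rho> (\<lambda>y. ennreal (k x y))"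

definition markov_kernel :: "'a measure \<Rightarrow> 'b measure \<Rightarrow> ('a \<Rightarrow> 'b measure) \<Rightarrow> bool" where
  "markov_kernel E S \<mu> \<longleftrightarrow> \<mu> \<in> E \<rightarrow>\<^sub>M prob_algebra S"

(* P(X \<in> dx | Y = y) = \<kappa> y (dx): \<kappa> is a probability kernel, and for each A in S,
   P(X \<in> A | Y) = \<kappa> Y A almost surely, where conditioning on Y means conditioning on
   the sigma-algebra generated by Y. *)
definition regular_cond_distr ::
  "'w measure \<Rightarrow> 's measure \<Rightarrow> ('w \<Rightarrow> 's) \<Rightarrow> 'g measure \<Rightarrow> ('w \<Rightarrow> 'g) \<Rightarrow> ('g \<Rightarrow> 's measure) \<Rightarrow> bool" where
  "regular_cond_distr P S X G Y \<kappa> \<longleftrightarrow>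
     markov_kernel G S \<kappa> \<and>
     (\<forall>A\<in>sets S. AE \<omega> in P.
        real_cond_exp P (vimage_algebra (space P) Y G) (\<lambda>\<omega>. indicator A (X \<omega>)) \<omega>
          = measure (\<kappa> (Y \<omega>)) A)"

definition fibre :: "'s measure \<Rightarrow> ('s \<Rightarrow> 'g) \<Rightarrow> 's \<Rightarrow> 's set" where
  "fibre S g s' = {s \<in> space S. g s = g s'}"

(* Since x / 0 = 0 in HOL, the value is 0 whenever one of the denominators vanishes.
   The parameter g s' equals g s on the fibre of s', which carries the proposal. *)
definition acceptance ::
  "('s \<Rightarrow> 'g) \<Rightarrow> ('g \<Rightarrow> 's \<Rightarrow> real) \<Rightarrow> ('s \<Rightarrow> 's \<Rightarrow> real) \<Rightarrow> ('s \<Rightarrow> real) \<Rightarrow> 's \<Rightarrow> 's \<Rightarrow> real" where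
  "acceptance g p k q s' s =
     min 1 ((p (g s') s * k s s') / (p (g s') s' * k s' s) * (q s / q s'))"

definition transition_mass ::
  "'s measure \<Rightarrow> 'l set \<Rightarrow> ('l \<Rightarrow> 's \<Rightarrow> real) \<Rightarrow> ('l \<Rightarrow> 's \<Rightarrow> 's \<Rightarrow> real) \<Rightarrow> ('l \<Rightarrow> 's \<Rightarrow> 's measure) \<Rightarrow>
   's \<Rightarrow> 's set \<Rightarrow> ennreal" where
  "transition_mass S L q a K s' B =
     (\<Sum>\<^sub>\<infinity>l\<in>L. ennreal (q l s') *
        (\<integral>\<^sup>+ s. (ennreal (a l s' s) * emeasure (return S s) B
               + ennreal (1 - a l s' s) * emeasure (return S s') B) \<partial>K l s'))"

definition transition_kernel ::
  "'s measure \<Rightarrow> 'l set \<Rightarrow> ('l \<Rightarrow> 's \<Rightarrow> real) \<Rightarrow> ('l \<Rightarrow> 's \<Rightarrow> 's \<Rightarrow> real) \<Rightarrow> ('l \<Rightarrow> 's \<Rightarrow> 's measure) \<Rightarrow>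
   's \<Rightarrow> 's measure" where
  "transition_kernel S L q a K s' =
     measure_of (space S) (sets S) (transition_mass S L q a K s')"

definition joint_mass :: "'s measure \<Rightarrow> ('s \<Rightarrow> 's measure) \<Rightarrow> 's set \<Rightarrow> 's set \<Rightarrow> ennreal" where
  "joint_mass \<pi> \<mu> A B = (\<integral>\<^sup>+ s'\<in>A. emeasure (\<mu> s') B \<partial>\<pi>)"

(* Being a Markov kernel is part of the notion. For a transition_kernel this also ensures
   that measure_of does not collapse to the null measure, so that its values on
   measurable sets are those of transition_mass. *)
definition preserves_detailed_balance :: "'s measure \<Rightarrow> 's measure \<Rightarrow> ('s \<Rightarrow> 's measure) \<Rightarrow> bool" where
  "preserves_detailed_balance S \<pi> \<mu> \<longleftrightarrow>
     markov_kernel S S \<mu> \<and>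
     (\<forall>A\<in>sets S. \<forall>B\<in>sets S. joint_mass \<pi> \<mu> A B = joint_mass \<pi> \<mu> B A)"

end

theory Submission
  imports Defs
begin

text \<open>Fix a move and write \<open>\<kappa> \<gamma>\<close> for the conditional law with density \<open>p \<gamma>\<close> with respect to \<open>\<Lambda>\<close>.
  Multiplying the minimum in the acceptance probability \<open>a s' s\<close> out gives, with \<open>\<gamma> = g s'\<close>,
  \<open>q s' * a s' s * k s' s = w \<gamma> s' s * p \<gamma> s\<close> where
  \<open>w \<gamma> s' s = min (q s' * k s' s / p \<gamma> s) (q s * k s s' / p \<gamma> s')\<close> is symmetric in \<open>s'\<close> and \<open>s\<close>.
  Hence \<open>q s'\<close> times the law of the accepted moves from \<open>s'\<close> has density \<open>w \<gamma> s'\<close> with respect to the probability measure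
  \<open>\<kappa> \<gamma>\<close>. As \<open>\<kappa>\<close> is a kernel and \<open>\<kappa> \<gamma>\<close> is finite, measurability in \<open>s'\<close> and Fubini's theorem are
  available, although \<open>\<Lambda>\<close> need not be sigma-finite. Disintegrating \<open>\<pi>\<close> along \<open>g\<close> turns the flow
  from \<open>A\<close> to \<open>B\<close> into the integral of \<open>w \<gamma>\<close> over \<open>A \<times> B\<close> against \<open>\<kappa> \<gamma> \<Otimes> \<kappa> \<gamma>\<close>, averaged over
  \<open>\<gamma>\<close>, which is symmetric in \<open>A\<close> and \<open>B\<close>. Rejected proposals stay in place and contribute
  symmetrically.\<close>

section \<open>Countable sums as integrals against counting measure\<close>

text \<open>Makes monotone convergence and Tonelli available for the sum over moves. An infinite
  index set is enumerated, which reduces the claim to an ordinary series.\<close>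

lemma infsum_ennreal_eq_nn_integral_count_space:
  fixes f :: "'i \<Rightarrow> ennreal"
  assumes "countable I"
  shows "infsum f I = (\<integral>\<^sup>+ i. f i \<partial>count_space I)"
proof (cases "finite I")
  case True
  then show ?thesis by (simp add: nn_integral_count_space_finite)
next
  case False
  have bij: "bij_betw (from_nat_into I) UNIV I"
    by (rule bij_betw_from_nat_into[OF assms False])
  \<comment> \<open>Every family in \<open>ennreal\<close> is summable, so the unordered sum exists
    and must agree with the series.\<close>
  have "((\<lambda>n. f (from_nat_into I n)) has_sum (\<Sum>\<^sub>\<infinity>n. f (from_nat_into I n))) UNIV"
    by (intro has_sum_infsum nonneg_summable_on_complete) simp
  then have "(\<Sum>\<^sub>\<infinity>n. f (from_nat_into I n)) = (\<Sum>n. f (from_nat_into I n))"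
    by (metis has_sum_imp_sums sums_unique)
  then show ?thesis
    by (simp add: infsum_reindex_bij_betw[OF bij, symmetric]
        nn_integral_bij_count_space[OF bij, symmetric] nn_integral_count_space_nat)
qed

section \<open>Disintegration of a joint law along the conditioning variable\<close>

text \<open>The conditional law is known only almost surely, with an exceptional set that may depend
  on the event. Comparing joint laws on measurable rectangles uses one event at a time, so these
  null sets never have to be united. Rectangles are stable under intersection and generate the
  product sigma-algebra, so finite measures agreeing on them coincide.\<close>

lemma regular_cond_distr_disintegration:
  assumes "prob_space P"
    and X[measurable]: "X \<in> P \<rightarrow>\<^sub>M S" and Y[measurable]: "Y \<in> P \<rightarrow>\<^sub>M G"
    and rcd: "regular_cond_distr P S X G Y \<kappa>"
    and f[measurable]: "f \<in> borel_measurable (G \<Otimes>\<^sub>M S)"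
  shows "(\<integral>\<^sup>+ \<omega>. f (Y \<omega>, X \<omega>) \<partial>P)
    = (\<integral>\<^sup>+ \<gamma>. \<integral>\<^sup>+ s. f (\<gamma>, s) \<partial>\<kappa> \<gamma> \<partial>distr P G Y)"
proof -
  interpret P: prob_space P by fact
  have \<kappa>p: "\<kappa> \<in> G \<rightarrow>\<^sub>M prob_algebra S"
    using rcd by (simp add: regular_cond_distr_def markov_kernel_def)
  then have \<kappa>[measurable]: "\<kappa> \<in> G \<rightarrow>\<^sub>M subprob_algebra S"
    by (rule measurable_prob_algebraD)
  define F where "F = vimage_algebra (space P) Y G"
  have subF: "subalgebra P F"
    using measurable_sets[OF Y] unfolding subalgebra_def F_def
    by (auto simp: sets_vimage_algebra2 measurable_space[OF Y])
  interpret F: finite_measure_subalgebra P F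
    by unfold_locales (rule subF)
  define J where "J = distr P (G \<Otimes>\<^sub>M S) (\<lambda>\<omega>. (Y \<omega>, X \<omega>))"
  \<comment> \<open>\<open>N \<gamma>\<close> is the product of the point mass at
    \<open>\<gamma>\<close> with \<open>\<kappa> \<gamma>\<close>; binding it to the law of
    \<open>Y\<close> builds the candidate for the joint law \<open>J\<close>.\<close>
  define N where "N = (\<lambda>\<gamma>. distr (\<kappa> \<gamma>) (G \<Otimes>\<^sub>M S) (Pair \<gamma>))"
  have "N \<in> G \<rightarrow>\<^sub>M subprob_algebra (G \<Otimes>\<^sub>M S)"
    unfolding N_def by (rule measurable_distr2[OF _ \<kappa>]) simp
  then have N: "N \<in> distr P G Y \<rightarrow>\<^sub>M subprob_algebra (G \<Otimes>\<^sub>M S)" by simp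
  have sets\<kappa>: "sets (\<kappa> \<gamma>) = sets S" "prob_space (\<kappa> \<gamma>)" if "\<gamma> \<in> space G" for \<gamma>
    using measurable_space[OF \<kappa>p that] by (auto simp: space_prob_algebra)
  have ne: "space (distr P G Y) \<noteq> {}"
    using P.not_empty measurable_space[OF Y] by auto
  have sets_bindN: "sets (distr P G Y \<bind> N) = sets (G \<Otimes>\<^sub>M S)"
    by (rule sets_bind[OF _ ne]) (simp add: N_def)
  have "prob_space J"
    unfolding J_def by (rule P.prob_space_distr) measurable
  then interpret J: prob_space J .
  have "J = distr P G Y \<bind> N"
  proof (rule measure_eqI_generator_eq[OF Int_stable_pair_measure_generator[of G S], where A="\<lambda>_. space G \<times> space S" and \<Omega>="space G \<times> space S"])
    show "{a \<times> b |a b. a \<in> sets G \<and> b \<in> sets S} \<subseteq> Pow (space G \<times> space S)"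
      by (rule pair_measure_closed)
    show "sets J = sigma_sets (space G \<times> space S) {a \<times> b |a b. a \<in> sets G \<and> b \<in> sets S}"
      unfolding J_def sets_distr by (rule sets_pair_measure)
    show "sets (distr P G Y \<bind> N) = sigma_sets (space G \<times> space S) {a \<times> b |a b. a \<in> sets G \<and> b \<in> sets S}"
      unfolding sets_bindN by (rule sets_pair_measure)
    show "range (\<lambda>_. space G \<times> space S) \<subseteq> {a \<times> b |a b. a \<in> sets G \<and> b \<in> sets S}" by auto
    show "(\<Union>i::nat. space G \<times> space S) = space G \<times> space S" by simp
    show "emeasure J (space G \<times> space S) \<noteq> \<infinity>"
      by simp
  next
    fix U assume "U \<in> {a \<times> b |a b. a \<in> sets G \<and> b \<in> sets S}"
    then obtain C A where U: "U = C \<times> A" and [measurable]: "C \<in> sets G" "A \<in> sets S" by auto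
    define D where "D = Y -` C \<inter> space P"
    have D[measurable]: "D \<in> sets F"
      unfolding D_def F_def by (rule in_vimage_algebra) fact
    then have DP[measurable]: "D \<in> sets P" using subF by (auto simp: subalgebra_def)
    have int: "integrable P (\<lambda>\<omega>. indicator A (X \<omega>) :: real)"
      by (rule P.integrable_const_bound[where B=1]) auto
    have intk: "integrable P (\<lambda>\<omega>. indicator D \<omega> * measure (\<kappa> (Y \<omega>)) A)"
      by (rule P.integrable_const_bound[where B=1])
         (auto intro!: AE_I2 simp: indicator_def
           prob_space.prob_le_1[OF sets\<kappa>(2)[OF measurable_space[OF Y]]])
    have "emeasure J U = emeasure P (D \<inter> (X -` A \<inter> space P))"
      unfolding J_def U by (subst emeasure_distr) (auto simp: D_def intro!: arg_cong[where f="emeasure P"])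
    \<comment> \<open>Conditional expectation is real-valued, so the computation passes to Bochner
      integrals here and returns to nonnegative ones once the kernel has been inserted.\<close>
    also have "\<dots> = ennreal (\<integral>\<omega>\<in>D. indicator A (X \<omega>) \<partial>P)"
    proof -
      have "(\<integral>\<omega>\<in>D. indicat_real A (X \<omega>) \<partial>P) = (\<integral>\<omega>. indicator (D \<inter> (X -` A \<inter> space P)) \<omega> \<partial>P)"
        unfolding set_lebesgue_integral_def by (intro Bochner_Integration.integral_cong) (auto simp: indicator_def)
      then show ?thesis by (simp add: P.emeasure_eq_measure)
    qed
    also have "(\<integral>\<omega>\<in>D. indicator A (X \<omega>) \<partial>P) = (\<integral>\<omega>\<in>D. real_cond_exp P F (\<lambda>\<omega>. indicator A (X \<omega>)) \<omega> \<partial>P)"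
      by (rule F.real_cond_exp_intA[OF int D])
    also have "\<dots> = (\<integral>\<omega>. indicator D \<omega> * measure (\<kappa> (Y \<omega>)) A \<partial>P)"
      unfolding set_lebesgue_integral_def real_scaleR_def
    proof (rule integral_cong_AE)
      have "AE \<omega> in P. real_cond_exp P F (\<lambda>\<omega>. indicator A (X \<omega>)) \<omega> = measure (\<kappa> (Y \<omega>)) A"
        using rcd \<open>A \<in> sets S\<close> by (auto simp: regular_cond_distr_def F_def)
      then show "AE \<omega> in P. indicator D \<omega> * real_cond_exp P F (\<lambda>\<omega>. indicator A (X \<omega>)) \<omega>
          = indicator D \<omega> * measure (\<kappa> (Y \<omega>)) A" by auto
    qed (use borel_measurable_integrable[OF intk] in measurable)
    also have "ennreal \<dots> = (\<integral>\<^sup>+\<omega>. ennreal (indicator D \<omega> * measure (\<kappa> (Y \<omega>)) A) \<partial>P)"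
      by (rule nn_integral_eq_integral[symmetric, OF intk]) auto
    also have "\<dots> = (\<integral>\<^sup>+\<omega>. indicator C (Y \<omega>) * emeasure (\<kappa> (Y \<omega>)) A \<partial>P)"
    proof (rule nn_integral_cong)
      fix \<omega> assume "\<omega> \<in> space P"
      then interpret K: prob_space "\<kappa> (Y \<omega>)" using sets\<kappa> measurable_space[OF Y] by auto
      show "ennreal (indicator D \<omega> * measure (\<kappa> (Y \<omega>)) A) = indicator C (Y \<omega>) * emeasure (\<kappa> (Y \<omega>)) A"
        using \<open>\<omega> \<in> space P\<close> by (auto simp: K.emeasure_eq_measure D_def indicator_def)
    qed
    also have "\<dots> = (\<integral>\<^sup>+\<gamma>. indicator C \<gamma> * emeasure (\<kappa> \<gamma>) A \<partial>distr P G Y)"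
      by (rule nn_integral_distr[symmetric]) auto
    also have "\<dots> = (\<integral>\<^sup>+\<gamma>. emeasure (N \<gamma>) U \<partial>distr P G Y)"
    proof (rule nn_integral_cong)
      fix \<gamma> assume "\<gamma> \<in> space (distr P G Y)"
      then have \<gamma>: "\<gamma> \<in> space G" by simp
      have "Pair \<gamma> \<in> \<kappa> \<gamma> \<rightarrow>\<^sub>M G \<Otimes>\<^sub>M S"
        using \<gamma> by (simp add: measurable_cong_sets[OF sets\<kappa>(1)[OF \<gamma>] refl] measurable_Pair1')
      then have "emeasure (N \<gamma>) U = emeasure (\<kappa> \<gamma>) (Pair \<gamma> -` U \<inter> space (\<kappa> \<gamma>))"
        unfolding N_def U by (subst emeasure_distr) auto
      also have "Pair \<gamma> -` U \<inter> space (\<kappa> \<gamma>) = (if \<gamma> \<in> C then A else {})"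
        using sets.sets_into_space[OF \<open>A \<in> sets S\<close>] sets_eq_imp_space_eq[OF sets\<kappa>(1)[OF \<gamma>]]
        by (auto simp: U)
      finally show "indicator C \<gamma> * emeasure (\<kappa> \<gamma>) A = emeasure (N \<gamma>) U" by simp
    qed
    also have "\<dots> = emeasure (distr P G Y \<bind> N) U"
      by (rule emeasure_bind[symmetric, OF ne N]) (simp add: U)
    finally show "emeasure J U = emeasure (distr P G Y \<bind> N) U" .
  qed
  then have "(\<integral>\<^sup>+ z. f z \<partial>J) = (\<integral>\<^sup>+ \<gamma>. \<integral>\<^sup>+ z. f z \<partial>N \<gamma> \<partial>distr P G Y)"
    using nn_integral_bind[OF f N] by simp
  also have "(\<integral>\<^sup>+ z. f z \<partial>J) = (\<integral>\<^sup>+ \<omega>. f (Y \<omega>, X \<omega>) \<partial>P)"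
    unfolding J_def by (rule nn_integral_distr) auto
  also have "(\<integral>\<^sup>+ \<gamma>. \<integral>\<^sup>+ z. f z \<partial>N \<gamma> \<partial>distr P G Y) = (\<integral>\<^sup>+ \<gamma>. \<integral>\<^sup>+ s. f (\<gamma>, s) \<partial>\<kappa> \<gamma> \<partial>distr P G Y)"
  proof (rule nn_integral_cong)
    fix \<gamma> assume "\<gamma> \<in> space (distr P G Y)"
    then have \<gamma>: "\<gamma> \<in> space G" by simp
    have "Pair \<gamma> \<in> \<kappa> \<gamma> \<rightarrow>\<^sub>M G \<Otimes>\<^sub>M S"
      using \<gamma> by (simp add: measurable_cong_sets[OF sets\<kappa>(1)[OF \<gamma>] refl] measurable_Pair1')
    then show "(\<integral>\<^sup>+ z. f z \<partial>N \<gamma>) = (\<integral>\<^sup>+ s. f (\<gamma>, s) \<partial>\<kappa> \<gamma>)"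
      unfolding N_def by (rule nn_integral_distr) simp
  qed
  finally show ?thesis .
qed

section \<open>A single Metropolis move\<close>

text \<open>Conditioning enters through \<open>disintegration\<close>, an integral identity under
  the target itself, so the analysis of one move can proceed without the random variable and its
  underlying probability space.\<close>

locale metropolis_move =
  fixes S \<pi> :: "'s measure" and G :: "'g measure" and g :: "'s \<Rightarrow> 'g"
    and \<Lambda> :: "'s measure" and p :: "'g \<Rightarrow> 's \<Rightarrow> real" and k :: "'s \<Rightarrow> 's \<Rightarrow> real"
    and q :: "'s \<Rightarrow> real"
  assumes sets_target[measurable_cong]: "sets \<pi> = sets S"
    and g[measurable]: "g \<in> S \<rightarrow>\<^sub>M G"
    and sets_ref[measurable_cong]: "sets \<Lambda> = sets S"
    and density_p: "kernel_density G \<Lambda> p"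
    and markov_p: "markov_kernel G S (density_kernel \<Lambda> p)"
    and density_k: "kernel_density S \<Lambda> k"
    and q[measurable]: "q \<in> borel_measurable S"
    and q_bounds: "\<And>s. s \<in> space S \<Longrightarrow> q s \<in> {0..1}"
    and disintegration: "\<And>f. f \<in> borel_measurable (G \<Otimes>\<^sub>M S) \<Longrightarrow>
      (\<integral>\<^sup>+ s. f (g s, s) \<partial>\<pi>)
        = (\<integral>\<^sup>+ \<gamma>. \<integral>\<^sup>+ s. f (\<gamma>, s) \<partial>density_kernel \<Lambda> p \<gamma> \<partial>distr \<pi> G g)"
begin

abbreviation "cond \<equiv> density_kernel \<Lambda> p"
abbreviation "proposal \<equiv> density_kernel \<Lambda> k"
abbreviation "accept \<equiv> acceptance g p k q"

text \<open>The density of an accepted move from \<open>s'\<close> to \<open>s\<close> with respect to the product of the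
  conditional law given \<open>g = \<gamma>\<close> with itself. A vanishing \<open>p \<gamma> s\<close> or \<open>p \<gamma> s'\<close> makes it \<open>0\<close>, in
  agreement with the convention for the acceptance probability.\<close>

definition weight :: "'g \<Rightarrow> 's \<Rightarrow> 's \<Rightarrow> real" where
  "weight \<gamma> s' s = min (q s' * k s' s / p \<gamma> s) (q s * k s s' / p \<gamma> s')"

text \<open>This is \<open>q s'\<close> times the probability that a proposal from \<open>s'\<close>
  is accepted and lands in \<open>B\<close>, rewritten over the conditional law; see
  \<open>accepted_mass_eq_flow\<close>.\<close>

definition flow :: "'s \<Rightarrow> 's set \<Rightarrow> ennreal" where
  "flow s' B = (\<integral>\<^sup>+ s. ennreal (weight (g s') s' s) * indicator B s \<partial>cond (g s'))"

text \<open>One summand of \<open>transition_mass\<close>: a sub-Markov kernel of total mass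
  \<open>q s'\<close>, by \<open>mass_space\<close>.\<close>

definition mass :: "'s \<Rightarrow> 's set \<Rightarrow> ennreal" where
  "mass s' B = ennreal (q s') * (\<integral>\<^sup>+ s. (ennreal (accept s' s) * emeasure (return S s) B
               + ennreal (1 - accept s' s) * emeasure (return S s') B) \<partial>proposal s')"

lemma weight_sym: "weight \<gamma> s' s = weight \<gamma> s s'"
  by (simp add: weight_def min.commute)

lemma space_ref: "space \<Lambda> = space S"
  by (rule sets_eq_imp_space_eq[OF sets_ref])

lemma p_measurable[measurable]: "(\<lambda>(\<gamma>, s). p \<gamma> s) \<in> borel_measurable (G \<Otimes>\<^sub>M S)"
  and k_measurable[measurable]: "(\<lambda>(s', s). k s' s) \<in> borel_measurable (S \<Otimes>\<^sub>M S)"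
  using density_p density_k
  by (simp_all add: kernel_density_def measurable_cong_sets[OF sets_pair_measure_cong[OF refl sets_ref] refl])

lemma p_nonneg: "\<gamma> \<in> space G \<Longrightarrow> s \<in> space S \<Longrightarrow> 0 \<le> p \<gamma> s"
  and k_nonneg: "s' \<in> space S \<Longrightarrow> s \<in> space S \<Longrightarrow> 0 \<le> k s' s"
  using density_p density_k by (auto simp: kernel_density_def space_ref)

lemma g_space: "s \<in> space S \<Longrightarrow> g s \<in> space G"
  by (rule measurable_space[OF g])

lemma cond_measurable[measurable]: "cond \<in> G \<rightarrow>\<^sub>M subprob_algebra S"
  using markov_p by (auto simp: markov_kernel_def intro: measurable_prob_algebraD)

lemma cond_prob_space: "\<gamma> \<in> space G \<Longrightarrow> prob_space (cond \<gamma>)"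
  using measurable_space[of cond G "prob_algebra S"] markov_p
  by (auto simp: markov_kernel_def space_prob_algebra)

lemma sets_cond[measurable_cong, simp]: "sets (cond \<gamma>) = sets S"
  and sets_proposal[measurable_cong, simp]: "sets (proposal s') = sets S"
  by (simp_all add: density_kernel_def sets_ref)

lemma p_section[measurable]: "\<gamma> \<in> space G \<Longrightarrow> p \<gamma> \<in> borel_measurable S"
  using measurable_compose[OF measurable_Pair1' p_measurable] by simp

lemma k_section[measurable]: "s' \<in> space S \<Longrightarrow> k s' \<in> borel_measurable S"
  using measurable_compose[OF measurable_Pair1' k_measurable] by simp

lemma proposal_prob_space: "s' \<in> space S \<Longrightarrow> prob_space (proposal s')"
proof
  assume s': "s' \<in> space S"
  then have [measurable]: "k s' \<in> borel_measurable \<Lambda>"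
    by (simp add: measurable_cong_sets[OF sets_ref refl])
  show "emeasure (proposal s') (space (proposal s')) = 1"
    using density_k s' unfolding density_kernel_def
    by (subst emeasure_density) (auto simp: kernel_density_def cong: nn_integral_cong)
qed

lemma weight_measurable[measurable (raw)]:
  assumes [measurable]: "a \<in> M \<rightarrow>\<^sub>M G" "b \<in> M \<rightarrow>\<^sub>M S" "c \<in> M \<rightarrow>\<^sub>M S"
  shows "(\<lambda>x. weight (a x) (b x) (c x)) \<in> borel_measurable M"
  unfolding weight_def by measurable

lemma weight_nonneg:
  "\<gamma> \<in> space G \<Longrightarrow> s' \<in> space S \<Longrightarrow> s \<in> space S \<Longrightarrow> 0 \<le> weight \<gamma> s' s"
  using q_bounds by (auto simp: weight_def p_nonneg k_nonneg)

lemma accept_bounds: "s' \<in> space S \<Longrightarrow> s \<in> space S \<Longrightarrow> accept s' s \<in> {0..1}"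
  using q_bounds by (auto simp: acceptance_def p_nonneg k_nonneg g_space)

lemma accept_measurable[measurable]: "(\<lambda>(s', s). accept s' s) \<in> borel_measurable (S \<Otimes>\<^sub>M S)"
  unfolding acceptance_def split_beta' by measurable

lemma accept_section[measurable]: "s' \<in> space S \<Longrightarrow> accept s' \<in> borel_measurable S"
  using measurable_compose[OF measurable_Pair1' accept_measurable] by simp

text \<open>If one of the four factors in the case distinction vanishes, both sides are 0, thanks to
  division by zero giving 0. Otherwise the positive factors can be multiplied into the minimum;
  \<open>q s\<close> and \<open>k s s'\<close> may still vanish there.\<close>

lemma q_accept_k_eq_weight:
  assumes "s' \<in> space S" "s \<in> space S"
  shows "q s' * accept s' s * k s' s = weight (g s') s' s * p (g s') s"
proof -
  have nn: "0 \<le> q s'" "0 \<le> q s" "0 \<le> k s' s" "0 \<le> k s s'" "0 \<le> p (g s') s" "0 \<le> p (g s') s'"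
    using assms q_bounds by (auto simp: p_nonneg k_nonneg g_space)
  show ?thesis
  proof (cases "q s' * k s' s * p (g s') s * p (g s') s' = 0")
    case True
    then show ?thesis using nn by (auto simp: acceptance_def weight_def)
  next
    case False
    then have pos: "0 < q s'" "0 < k s' s" "0 < p (g s') s" "0 < p (g s') s'"
      using nn by auto
    have "q s' * accept s' s * k s' s = (q s' * k s' s) * accept s' s" by simp
    also have "\<dots> = min (q s' * k s' s) (q s * k s s' / p (g s') s' * p (g s') s)"
      unfolding acceptance_def using pos by (subst min_mult_distrib_left) (auto simp: field_simps)
    also have "\<dots> = weight (g s') s' s * p (g s') s"
      unfolding weight_def using pos by (subst min_mult_distrib_right) auto
    finally show ?thesis .
  qed
qed

text \<open>The measure of integration moves with \<open>s'\<close>, but it is the probability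
  kernel \<open>cond\<close> composed with \<open>g\<close>.\<close>

lemma flow_measurable[measurable]:
  assumes [measurable]: "B \<in> sets S"
  shows "(\<lambda>s'. flow s' B) \<in> borel_measurable S"
  unfolding flow_def
  by (rule nn_integral_measurable_subprob_algebra2[where N=S]) measurable

text \<open>Written out against the common reference measure \<open>\<Lambda>\<close>, the two
  integrands agree pointwise by \<open>q_accept_k_eq_weight\<close>.\<close>

lemma accepted_mass_eq_flow:
  assumes s': "s' \<in> space S" and [measurable]: "B \<in> sets S"
  shows "ennreal (q s') * (\<integral>\<^sup>+ s. ennreal (accept s' s) * indicator B s \<partial>proposal s') = flow s' B"
proof -
  have [measurable]: "k s' \<in> borel_measurable \<Lambda>" "p (g s') \<in> borel_measurable \<Lambda>"
    "accept s' \<in> borel_measurable \<Lambda>" "B \<in> sets \<Lambda>"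
    using s' g_space by (simp_all add: measurable_cong_sets[OF sets_ref refl] sets_ref)
  have w[measurable]: "(\<lambda>s. weight (g s') s' s) \<in> borel_measurable \<Lambda>"
    using s' g_space by measurable
  have "ennreal (q s') * (\<integral>\<^sup>+ s. ennreal (accept s' s) * indicator B s \<partial>proposal s')
      = (\<integral>\<^sup>+ s. ennreal (q s') * (ennreal (k s' s) * (ennreal (accept s' s) * indicator B s)) \<partial>\<Lambda>)"
    unfolding density_kernel_def by (subst nn_integral_density) (auto simp: nn_integral_cmult)
  also have "\<dots> = (\<integral>\<^sup>+ s. ennreal (p (g s') s) * (ennreal (weight (g s') s' s) * indicator B s) \<partial>\<Lambda>)"
  proof (rule nn_integral_cong)
    fix s assume "s \<in> space \<Lambda>"
    then have s: "s \<in> space S" by (simp add: space_ref)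
    have "ennreal (q s') * (ennreal (k s' s) * ennreal (accept s' s))
        = ennreal (q s' * accept s' s * k s' s)"
      using q_bounds[OF s'] accept_bounds[OF s' s] k_nonneg[OF s' s]
      by (simp add: ennreal_mult[symmetric] ac_simps)
    also have "\<dots> = ennreal (p (g s') s) * ennreal (weight (g s') s' s)"
      using weight_nonneg[OF g_space[OF s'] s' s] p_nonneg[OF g_space[OF s'] s]
      unfolding q_accept_k_eq_weight[OF s' s] by (simp add: ennreal_mult mult.commute)
    finally show "ennreal (q s') * (ennreal (k s' s) * (ennreal (accept s' s) * indicator B s))
      = ennreal (p (g s') s) * (ennreal (weight (g s') s' s) * indicator B s)"
      by (simp add: mult.assoc[symmetric])
  qed
  also have "\<dots> = flow s' B"
    unfolding flow_def density_kernel_def by (rule nn_integral_density[symmetric]) auto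
  finally show ?thesis .
qed

text \<open>Whatever part of \<open>q s'\<close> does not flow away sits as a point mass at
  \<open>s'\<close>. In this form measurability in \<open>s'\<close> reduces to that of
  \<open>flow\<close>, and the rejected part is visibly diagonal.\<close>

lemma mass_eq:
  assumes s': "s' \<in> space S" and [measurable]: "B \<in> sets S"
  shows "mass s' B = flow s' B + (ennreal (q s') - flow s' (space S)) * indicator B s'"
proof -
  interpret K: prob_space "proposal s'" by (rule proposal_prob_space[OF s'])
  have spK: "space (proposal s') = space S" by (rule sets_eq_imp_space_eq) simp
  have a[measurable]: "accept s' \<in> borel_measurable (proposal s')" "B \<in> sets (proposal s')"
    using s' by simp_all
  let ?A = "\<lambda>s. ennreal (accept s' s)"
  \<comment> \<open>The bound makes the accepted mass finite, as subtraction of integrals in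
    \<open>ennreal\<close> requires.\<close>
  have le: "(\<integral>\<^sup>+ s. ?A s \<partial>proposal s') \<le> 1"
    using nn_integral_mono[of "proposal s'" ?A "\<lambda>_. 1"] accept_bounds[OF s'] K.emeasure_space_1
    by (simp add: spK)
  have "(\<integral>\<^sup>+ s. ennreal (1 - accept s' s) \<partial>proposal s') = (\<integral>\<^sup>+ s. 1 - ?A s \<partial>proposal s')"
    by (intro nn_integral_cong) (use accept_bounds[OF s'] in \<open>auto simp: spK ennreal_minus[symmetric]\<close>)
  also have "\<dots> = 1 - (\<integral>\<^sup>+ s. ?A s \<partial>proposal s')"
    using le accept_bounds[OF s'] K.emeasure_space_1
    by (subst nn_integral_diff) (auto simp: spK top_unique)
  finally have rej: "(\<integral>\<^sup>+ s. ennreal (1 - accept s' s) \<partial>proposal s')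
      = 1 - (\<integral>\<^sup>+ s. ?A s \<partial>proposal s')" .
  have all: "ennreal (q s') * (\<integral>\<^sup>+ s. ?A s \<partial>proposal s') = flow s' (space S)"
    by (subst accepted_mass_eq_flow[OF s', symmetric])
       (auto intro!: arg_cong2[where f="(*)"] nn_integral_cong simp: spK)
  have "mass s' B = ennreal (q s') * ((\<integral>\<^sup>+ s. ?A s * indicator B s \<partial>proposal s')
      + (\<integral>\<^sup>+ s. ennreal (1 - accept s' s) * indicator B s' \<partial>proposal s'))"
    unfolding mass_def by (subst nn_integral_add[symmetric]) (auto simp: intro!: nn_integral_cong)
  also have "\<dots> = flow s' B + ennreal (q s') * (1 - (\<integral>\<^sup>+ s. ?A s \<partial>proposal s')) * indicator B s'"
    using accepted_mass_eq_flow[OF s' \<open>B \<in> sets S\<close>]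
    by (simp add: nn_integral_multc rej distrib_left mult.assoc)
  also have "ennreal (q s') * (1 - (\<integral>\<^sup>+ s. ?A s \<partial>proposal s')) = ennreal (q s') - flow s' (space S)"
    by (simp add: ennreal_right_diff_distrib all)
  finally show ?thesis .
qed

lemma mass_measurable[measurable]:
  assumes [measurable]: "B \<in> sets S"
  shows "(\<lambda>s'. mass s' B) \<in> borel_measurable S"
  by (subst measurable_cong[OF mass_eq]) auto

lemma mass_space:
  assumes s': "s' \<in> space S"
  shows "mass s' (space S) = ennreal (q s')"
proof -
  interpret K: prob_space "proposal s'" by (rule proposal_prob_space[OF s'])
  have spK: "space (proposal s') = space S" by (rule sets_eq_imp_space_eq) simp
  have "mass s' (space S) = ennreal (q s') * (\<integral>\<^sup>+ s. 1 \<partial>proposal s')"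
    unfolding mass_def
  proof (intro arg_cong2[where f="(*)"] nn_integral_cong refl)
    fix s assume "s \<in> space (proposal s')"
    then show "ennreal (accept s' s) * emeasure (return S s) (space S)
        + ennreal (1 - accept s' s) * emeasure (return S s') (space S) = 1"
      using s' accept_bounds[of s' s] by (simp add: spK ennreal_plus[symmetric] del: ennreal_plus)
  qed
  then show ?thesis by (simp add: K.emeasure_space_1)
qed

text \<open>Countable additivity of one summand, needed later so that \<open>measure_of\<close>
  really returns the given set function. It is inherited from the point masses by exchanging series
  and integral.\<close>

lemma mass_suminf:
  assumes s': "s' \<in> space S" and B: "range B \<subseteq> sets S" "disjoint_family B"
  shows "(\<Sum>i. mass s' (B i)) = mass s' (\<Union>i. B i)"
proof -
  have [measurable]: "B i \<in> sets S" for i using B by auto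
  have [measurable]: "accept s' \<in> borel_measurable (proposal s')" "B i \<in> sets (proposal s')" for i
    using s' by simp_all
  have "(\<Sum>i. emeasure (return S s) (B i)) = emeasure (return S s) (\<Union>i. B i)" for s
    by (rule suminf_emeasure) (use B in auto)
  then show ?thesis
    unfolding mass_def
    by (simp add: nn_integral_suminf[symmetric] suminf_add[symmetric])
qed

section \<open>Reversibility of a single move\<close>

text \<open>\<open>flow s' B\<close> depends on \<open>s'\<close> directly and through
  \<open>g s'\<close>. Reading it as a function \<open>h\<close> of the pair
  \<open>(g s', s')\<close> lets \<open>disintegration\<close> replace \<open>g s'\<close> by a free
  parameter \<open>\<gamma>\<close>, after which \<open>s'\<close> and \<open>s\<close> are both
  drawn from \<open>cond \<gamma>\<close>.\<close>

lemma flow_eq_double_integral: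
  assumes [measurable]: "A \<in> sets S" "B \<in> sets S"
  shows "(\<integral>\<^sup>+ s'\<in>A. flow s' B \<partial>\<pi>) = (\<integral>\<^sup>+ \<gamma>. \<integral>\<^sup>+ s'. \<integral>\<^sup>+ s.
      ennreal (weight \<gamma> s' s) * indicator B s * indicator A s' \<partial>cond \<gamma> \<partial>cond \<gamma> \<partial>distr \<pi> G g)"
proof -
  define h where "h = (\<lambda>(\<gamma>, s'). \<integral>\<^sup>+ s. ennreal (weight \<gamma> s' s) * indicator B s * indicator A s' \<partial>cond \<gamma>)"
  have "(\<lambda>z. \<integral>\<^sup>+ s. ennreal (weight (fst z) (snd z) s) * indicator B s * indicator A (snd z) \<partial>cond (fst z))
      \<in> borel_measurable (G \<Otimes>\<^sub>M S)"
    by (rule nn_integral_measurable_subprob_algebra2[where N=S]) measurable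
  then have h: "h \<in> borel_measurable (G \<Otimes>\<^sub>M S)"
    by (simp add: h_def split_beta')
  have "(\<integral>\<^sup>+ s'\<in>A. flow s' B \<partial>\<pi>) = (\<integral>\<^sup>+ s'. h (g s', s') \<partial>\<pi>)"
  proof (rule nn_integral_cong)
    fix s' assume "s' \<in> space \<pi>"
    then have s': "s' \<in> space S" using sets_eq_imp_space_eq[OF sets_target] by simp
    have "(\<lambda>s. ennreal (weight (g s') s' s) * indicator B s) \<in> borel_measurable (cond (g s'))"
      using s' g_space by measurable
    then show "flow s' B * indicator A s' = h (g s', s')"
      by (simp add: h_def flow_def nn_integral_multc)
  qed
  then show ?thesis
    using disintegration[OF h] by (simp add: h_def)
qed

text \<open>For fixed \<open>\<gamma>\<close>, Tonelli exchanges the two variables, and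
  \<open>weight_sym\<close> restores the integrand with \<open>A\<close> and \<open>B\<close>
  swapped.\<close>

lemma flow_reversible:
  assumes [measurable]: "A \<in> sets S" "B \<in> sets S"
  shows "(\<integral>\<^sup>+ s'\<in>A. flow s' B \<partial>\<pi>) = (\<integral>\<^sup>+ s'\<in>B. flow s' A \<partial>\<pi>)"
  unfolding flow_eq_double_integral[OF assms] flow_eq_double_integral[OF assms(2,1)]
proof (rule nn_integral_cong)
  fix \<gamma> assume "\<gamma> \<in> space (distr \<pi> G g)"
  then have \<gamma>[measurable]: "\<gamma> \<in> space G" by simp
  interpret C: prob_space "cond \<gamma>" by (rule cond_prob_space[OF \<gamma>])
  interpret CC: pair_sigma_finite "cond \<gamma>" "cond \<gamma>" ..
  have "(\<integral>\<^sup>+ s'. \<integral>\<^sup>+ s. ennreal (weight \<gamma> s' s) * indicator B s * indicator A s' \<partial>cond \<gamma> \<partial>cond \<gamma>)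
      = (\<integral>\<^sup>+ s. \<integral>\<^sup>+ s'. ennreal (weight \<gamma> s' s) * indicator B s * indicator A s' \<partial>cond \<gamma> \<partial>cond \<gamma>)"
    by (rule CC.Fubini') measurable
  also have "\<dots> = (\<integral>\<^sup>+ s'. \<integral>\<^sup>+ s. ennreal (weight \<gamma> s' s) * indicator A s * indicator B s' \<partial>cond \<gamma> \<partial>cond \<gamma>)"
    by (intro nn_integral_cong) (subst weight_sym, simp only: ac_simps)
  finally show "(\<integral>\<^sup>+ s'. \<integral>\<^sup>+ s. ennreal (weight \<gamma> s' s) * indicator B s * indicator A s' \<partial>cond \<gamma> \<partial>cond \<gamma>)
      = (\<integral>\<^sup>+ s'. \<integral>\<^sup>+ s. ennreal (weight \<gamma> s' s) * indicator A s * indicator B s' \<partial>cond \<gamma> \<partial>cond \<gamma>)" .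
qed

text \<open>By \<open>mass_eq\<close> the rejected part is an integral over
  \<open>A \<inter> B\<close>, symmetric on its own; the accepted part is
  \<open>flow_reversible\<close>.\<close>

lemma mass_reversible:
  assumes [measurable]: "A \<in> sets S" "B \<in> sets S"
  shows "(\<integral>\<^sup>+ s'\<in>A. mass s' B \<partial>\<pi>) = (\<integral>\<^sup>+ s'\<in>B. mass s' A \<partial>\<pi>)"
proof -
  have split: "(\<integral>\<^sup>+ s'\<in>A. mass s' B \<partial>\<pi>) = (\<integral>\<^sup>+ s'\<in>A. flow s' B \<partial>\<pi>)
      + (\<integral>\<^sup>+ s'\<in>A \<inter> B. (ennreal (q s') - flow s' (space S)) \<partial>\<pi>)"
    if [measurable]: "A \<in> sets S" "B \<in> sets S" for A B
  proof -
    have "(\<integral>\<^sup>+ s'\<in>A. mass s' B \<partial>\<pi>) = (\<integral>\<^sup>+ s'. flow s' B * indicator A s'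
        + (ennreal (q s') - flow s' (space S)) * indicator (A \<inter> B) s' \<partial>\<pi>)"
      by (intro nn_integral_cong)
         (auto simp: mass_eq sets_eq_imp_space_eq[OF sets_target] indicator_def)
    also have "\<dots> = (\<integral>\<^sup>+ s'\<in>A. flow s' B \<partial>\<pi>)
      + (\<integral>\<^sup>+ s'\<in>A \<inter> B. (ennreal (q s') - flow s' (space S)) \<partial>\<pi>)"
      by (rule nn_integral_add) measurable
    finally show ?thesis .
  qed
  show ?thesis
    by (simp add: split assms flow_reversible[OF assms] Int_commute)
qed

end

section \<open>Mixing countably many moves\<close>

text \<open>For nonnegative terms both sums are the supremum of the finite partial sums. This
  carries the normalization of the move probabilities over to \<open>ennreal\<close>.\<close>

lemma has_sum_imp_infsum_ennreal:
  assumes "(f has_sum x) I" "\<And>i. i \<in> I \<Longrightarrow> 0 \<le> f i"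
  shows "(\<Sum>\<^sub>\<infinity>i\<in>I. ennreal (f i)) = ennreal x"
proof -
  have "f summable_on I" "infsum f I = x"
    using assms(1) by (auto simp: has_sum_imp_summable infsumI)
  then have "ennreal x = (SUP F\<in>{F. finite F \<and> F \<subseteq> I}. ennreal (sum f F))"
    using infsum_nonneg_is_SUPREMUM_ennreal[of f I] assms(2) by auto
  also have "\<dots> = (SUP F\<in>{F. finite F \<and> F \<subseteq> I}. \<Sum>i\<in>F. ennreal (f i))"
    using assms(2) by (intro SUP_cong refl sum_ennreal[symmetric]) auto
  also have "\<dots> = (\<Sum>\<^sub>\<infinity>i\<in>I. ennreal (f i))"
    by (rule nonneg_infsum_complete[symmetric]) simp
  finally show ?thesis by simp
qed

theorem lemma4:
  fixes S \<pi> :: "'s measure" and P :: "'w measure" and X :: "'w \<Rightarrow> 's"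
    and L :: "'l set"
    and G :: "'l \<Rightarrow> 'g measure" and g :: "'l \<Rightarrow> 's \<Rightarrow> 'g"
    and \<Lambda> :: "'l \<Rightarrow> 's measure"
    and p :: "'l \<Rightarrow> 'g \<Rightarrow> 's \<Rightarrow> real"
    and k :: "'l \<Rightarrow> 's \<Rightarrow> 's \<Rightarrow> real"
    and q :: "'l \<Rightarrow> 's \<Rightarrow> real"
  assumes "prob_space \<pi>" and "sets \<pi> = sets S"
    and "prob_space P" and "X \<in> P \<rightarrow>\<^sub>M S" and "distr P S X = \<pi>"
    and "countable L"
    and "\<And>l. l \<in> L \<Longrightarrow> g l \<in> S \<rightarrow>\<^sub>M G l"
    and "\<And>l x. l \<in> L \<Longrightarrow> x \<in> space (G l) \<Longrightarrow> {x} \<in> sets (G l)"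
    and "\<And>l. l \<in> L \<Longrightarrow> sets (\<Lambda> l) = sets S"
    and "\<And>l. l \<in> L \<Longrightarrow> kernel_density (G l) (\<Lambda> l) (p l)"
    and "\<And>l. l \<in> L \<Longrightarrow>
           regular_cond_distr P S X (G l) (\<lambda>\<omega>. g l (X \<omega>)) (density_kernel (\<Lambda> l) (p l))"
    and "\<And>l s'. l \<in> L \<Longrightarrow> s' \<in> space S \<Longrightarrow>
           sigma_finite_measure (restrict_space (\<Lambda> l) (fibre S (g l) s'))"
    and "\<And>l. l \<in> L \<Longrightarrow> kernel_density S (\<Lambda> l) (k l)"
    and "\<And>l s'. l \<in> L \<Longrightarrow> s' \<in> space S \<Longrightarrow>
           emeasure (density_kernel (\<Lambda> l) (k l) s') (fibre S (g l) s') = 1"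
    and "\<And>l. l \<in> L \<Longrightarrow> q l \<in> borel_measurable S"
    and "\<And>l s'. l \<in> L \<Longrightarrow> s' \<in> space S \<Longrightarrow> q l s' \<in> {0..1}"
    and "\<And>s'. s' \<in> space S \<Longrightarrow> ((\<lambda>l. q l s') has_sum 1) L"
  shows "preserves_detailed_balance S \<pi>
           (transition_kernel S L q (\<lambda>l. acceptance (g l) (p l) (k l) (q l))
              (\<lambda>l. density_kernel (\<Lambda> l) (k l)))"
proof -
  let ?a = "\<lambda>l. acceptance (g l) (p l) (k l) (q l)"
  let ?K = "\<lambda>l. density_kernel (\<Lambda> l) (k l)"
  let ?\<mu> = "transition_kernel S L q ?a ?K"
  let ?m = "\<lambda>l. metropolis_move.mass S (g l) (\<Lambda> l) (p l) (k l) (q l)"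
  note sets_\<pi> = \<open>sets \<pi> = sets S\<close>
  note X = \<open>X \<in> P \<rightarrow>\<^sub>M S\<close>
  have M: "metropolis_move S \<pi> (G l) (g l) (\<Lambda> l) (p l) (k l) (q l)" if l: "l \<in> L" for l
  proof
    note g = assms(7)[OF l]
    note rcd = assms(11)[OF l]
    show "markov_kernel (G l) S (density_kernel (\<Lambda> l) (p l))"
      using rcd by (simp add: regular_cond_distr_def)
    fix f :: "'g \<times> 's \<Rightarrow> ennreal" assume f: "f \<in> borel_measurable (G l \<Otimes>\<^sub>M S)"
    \<comment> \<open>The integral is pulled back along \<open>X\<close> to \<open>P\<close>, where
      the conditional law is given; the law of \<open>g l (X \<omega>)\<close> is then identified
      with the image of \<open>\<pi>\<close>.\<close>
    have "(\<integral>\<^sup>+ s. f (g l s, s) \<partial>\<pi>) = (\<integral>\<^sup>+ \<omega>. f (g l (X \<omega>), X \<omega>) \<partial>P)"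
      unfolding assms(5)[symmetric] using X g f by (subst nn_integral_distr) auto
    also have "\<dots> = (\<integral>\<^sup>+ \<gamma>. \<integral>\<^sup>+ s. f (\<gamma>, s) \<partial>density_kernel (\<Lambda> l) (p l) \<gamma>
        \<partial>distr P (G l) (\<lambda>\<omega>. g l (X \<omega>)))"
      by (rule regular_cond_distr_disintegration[OF assms(3) X measurable_compose[OF X g] rcd f])
    also have "distr P (G l) (\<lambda>\<omega>. g l (X \<omega>)) = distr \<pi> (G l) (g l)"
      unfolding assms(5)[symmetric] by (subst distr_distr[OF g X]) (simp add: comp_def)
    finally show "(\<integral>\<^sup>+ s. f (g l s, s) \<partial>\<pi>)
        = (\<integral>\<^sup>+ \<gamma>. \<integral>\<^sup>+ s. f (\<gamma>, s) \<partial>density_kernel (\<Lambda> l) (p l) \<gamma> \<partial>distr \<pi> (G l) (g l))" .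
  qed (fact assms(2), fact assms(7)[OF l], fact assms(9)[OF l], fact assms(10)[OF l],
      fact assms(13)[OF l], fact assms(15)[OF l], fact assms(16)[OF l])
  have tm: "transition_mass S L q ?a ?K s' B = (\<integral>\<^sup>+ l. ?m l s' B \<partial>count_space L)" for s' B
    unfolding transition_mass_def infsum_ennreal_eq_nn_integral_count_space[OF \<open>countable L\<close>]
    by (intro nn_integral_cong) (simp add: metropolis_move.mass_def[OF M])
  have sets_\<mu>[simp]: "sets (?\<mu> s') = sets S" for s'
    by (simp add: transition_kernel_def)
  \<comment> \<open>\<open>measure_of\<close> would yield the null measure if the set function were
    not positive and countably additive, so both are checked before its values are read off.\<close>
  have \<mu>: "emeasure (?\<mu> s') B = (\<integral>\<^sup>+ l. ?m l s' B \<partial>count_space L)"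
    if s': "s' \<in> space S" and B: "B \<in> sets S" for s' B
    unfolding transition_kernel_def tm[symmetric]
  proof (rule emeasure_measure_of_sigma[OF _ _ _ B])
    show "sigma_algebra (space S) (sets S)" ..
    show "positive (sets S) (transition_mass S L q ?a ?K s')"
      by (simp add: positive_def transition_mass_def)
    show "countably_additive (sets S) (transition_mass S L q ?a ?K s')"
      unfolding countably_additive_def tm
    proof (intro allI impI)
      fix B :: "nat \<Rightarrow> 's set"
      assume B: "range B \<subseteq> sets S" "disjoint_family B"
      have "(\<Sum>i. \<integral>\<^sup>+ l. ?m l s' (B i) \<partial>count_space L) = (\<integral>\<^sup>+ l. (\<Sum>i. ?m l s' (B i)) \<partial>count_space L)"
        by (rule nn_integral_suminf[symmetric]) simp
      also have "\<dots> = (\<integral>\<^sup>+ l. ?m l s' (\<Union>i. B i) \<partial>count_space L)"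
        by (intro nn_integral_cong) (simp add: metropolis_move.mass_suminf[OF M s' B])
      finally show "(\<Sum>i. \<integral>\<^sup>+ l. ?m l s' (B i) \<partial>count_space L) = (\<integral>\<^sup>+ l. ?m l s' (\<Union>i. B i) \<partial>count_space L)" .
    qed
  qed
  have prob: "prob_space (?\<mu> s')" if s': "s' \<in> space S" for s'
  proof
    have "emeasure (?\<mu> s') (space (?\<mu> s')) = (\<integral>\<^sup>+ l. ?m l s' (space S) \<partial>count_space L)"
      using \<mu>[OF s'] sets_eq_imp_space_eq[OF sets_\<mu>] by simp
    also have "\<dots> = (\<integral>\<^sup>+ l. ennreal (q l s') \<partial>count_space L)"
      by (intro nn_integral_cong) (simp add: metropolis_move.mass_space[OF M s'])
    also have "\<dots> = (\<Sum>\<^sub>\<infinity>l\<in>L. ennreal (q l s'))"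
      by (rule infsum_ennreal_eq_nn_integral_count_space[OF \<open>countable L\<close>, symmetric])
    also have "\<dots> = 1"
      using has_sum_imp_infsum_ennreal[OF assms(17)[OF s']] assms(16)[OF _ s'] by simp
    finally show "emeasure (?\<mu> s') (space (?\<mu> s')) = 1" .
  qed
  have meas: "(\<lambda>s'. emeasure (?\<mu> s') B) \<in> borel_measurable S" if B: "B \<in> sets S" for B
  proof -
    interpret C: sigma_finite_measure "count_space L"
      by (rule sigma_finite_measure_count_space_countable[OF \<open>countable L\<close>])
    \<comment> \<open>With countably many moves, measurability for each \<open>l\<close> already
      gives joint measurability in the state and the move.\<close>
    have "(\<lambda>z. ?m (snd z) (fst z) B) \<in> borel_measurable (S \<Otimes>\<^sub>M count_space L)"
      by (rule measurable_compose_countable'[OF _ measurable_snd \<open>countable L\<close>])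
         (rule measurable_compose[OF measurable_fst metropolis_move.mass_measurable[OF M B]])
    then have "(\<lambda>s'. \<integral>\<^sup>+ l. ?m l s' B \<partial>count_space L) \<in> borel_measurable S"
      by (intro C.borel_measurable_nn_integral) (simp add: split_beta')
    then show ?thesis by (subst measurable_cong[OF \<mu>[OF _ B]])
  qed
  have joint: "joint_mass \<pi> ?\<mu> A B = (\<integral>\<^sup>+ l. (\<integral>\<^sup>+ s'\<in>A. ?m l s' B \<partial>\<pi>) \<partial>count_space L)"
    if A: "A \<in> sets S" and B: "B \<in> sets S" for A B
  proof -
    have m: "(\<lambda>s'. ?m l s' B * indicator A s') \<in> borel_measurable \<pi>" if "l \<in> L" for l
      using metropolis_move.mass_measurable[OF M[OF that] B] A
      by (simp add: measurable_cong_sets[OF sets_\<pi> refl])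
    have "joint_mass \<pi> ?\<mu> A B = (\<integral>\<^sup>+ s'. \<integral>\<^sup>+ l. ?m l s' B * indicator A s' \<partial>count_space L \<partial>\<pi>)"
      unfolding joint_mass_def
      by (intro nn_integral_cong)
         (simp add: \<mu>[OF _ B] sets_eq_imp_space_eq[OF sets_\<pi>] nn_integral_multc)
    also have "\<dots> = (\<integral>\<^sup>+ l. (\<integral>\<^sup>+ s'\<in>A. ?m l s' B \<partial>\<pi>) \<partial>count_space L)"
      by (rule nn_integral_count_space_nn_integral[OF \<open>countable L\<close> m])
    finally show ?thesis .
  qed
  show ?thesis
    unfolding preserves_detailed_balance_def markov_kernel_def
  proof (intro conjI ballI)
    show "?\<mu> \<in> S \<rightarrow>\<^sub>M prob_algebra S"
      by (intro measurable_prob_algebraI measurable_subprob_algebra prob prob_space_imp_subprob_space meas)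
         simp_all
    fix A B assume AB: "A \<in> sets S" "B \<in> sets S"
    show "joint_mass \<pi> ?\<mu> A B = joint_mass \<pi> ?\<mu> B A"
      unfolding joint[OF AB] joint[OF AB(2,1)]
      by (rule nn_integral_cong) (simp add: metropolis_move.mass_reversible[OF M AB])
  qed
qed

end
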